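(* Let $n\ge1$ and let $a,b>0$ and $c\ne0$ be real numbers with $a=b+c^2$. Then the non-Riemannian $U(n+1)$-invariant Randers metric $F_{a,b,c}$ on $S^{2n+1}=U(n+1)/U(n)$ is Clifford-Wolf homogeneous.
   Context: $S^{2n+1}$ is the unit sphere in $\mathbb{C}^{n+1}$ with the standard linear action of $U(n+1)$. At the base point $e_{n+1}=(0,\dots,0,1)^T$ identify the tangent space with $\mathbb{R}\oplus\mathbb{C}^n\ni(q,u)$, the pair $(q,u)$ corresponding to the tangent vector $(u,\sqrt{-1}q)\in\mathbb{C}^n\oplus\mathbb{C}$, and put $F_{a,b,c}(q,u)=\sqrt{a q^2+b\,u^*u}+c\,q$, extended to $S^{2n+1}$ by $U(n+1)$-invariance. Equivalently, for $z\in S^{2n+1}$ and a tangent vector $w$ at $z$, with $q=\operatorname{Im}(z^*w)$, $F_{a,b,c}(z,w)=\sqrt{a q^2+b|w-\sqrt{-1}qz|^2}+cq$. For $a,b>0$ and $0<|c|<\sqrt a$ this is a non-Riemannian Randers metric (a Finsler metric of the form $\alpha+\beta$ with $\alpha$ Riemannian and $\beta$ a nonzero 1-form of $\alpha$-length everywhere $<1$); the condition $|c|<\sqrt a$ is automatic when $a=b+c^2$. For a Finsler manifold $(M,F)$, the (possibly non-symmetric) distance $d(x,y)$ is the infimum of $F$-lengths of piecewise smooth curves from $x$ to $y$. A Clifford-Wolf translation is an isometry $\rho$ of $(M,F)$ such that $x\mapsto d(x,\rho(x))$ is constant. $(M,F)$ is Clifford-Wolf homogeneous if for any $x_1,x_2\in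 M$ there is a Clifford-Wolf translation $\sigma$ with $\sigma(x_1)=x_2$. *)

theory Defs
  imports "HOL-Analysis.Analysis"
begin

text \<open>
  Manifolds are embedded submanifolds \<open>M\<close> of a Euclidean space. A Finsler metric is a function
  \<open>F x w\<close> of a point and an ambient vector, used only for \<open>x \<in> M\<close> and \<open>w\<close> tangent to \<open>M\<close> at \<open>x\<close>.
\<close>

primrec Ck_on :: "nat \<Rightarrow> ('a::euclidean_space \<Rightarrow> 'b::euclidean_space) \<Rightarrow> 'a set \<Rightarrow> bool" where
  "Ck_on 0 f U \<longleftrightarrow> continuous_on U f"
| "Ck_on (Suc k) f U \<longleftrightarrow> (\<forall>x\<in>U. f differentiable (at x)) \<and>
     (\<forall>v. Ck_on k (\<lambda>x. frechet_derivative f (at x) v) U)"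

text \<open>Smoothness on an arbitrary subset: locally the restriction of a \<open>C\<^sup>\<infinity>\<close> map on an open set.\<close>

definition smooth_on :: "'a::euclidean_space set \<Rightarrow> ('a \<Rightarrow> 'b::euclidean_space) \<Rightarrow> bool" where
  "smooth_on S f \<longleftrightarrow> (\<forall>x\<in>S. \<exists>U g. open U \<and> x \<in> U \<and> (\<forall>k. Ck_on k g U) \<and> (\<forall>y\<in>S \<inter> U. g y = f y))"

text \<open>
  \<open>P\<close> is the set of break points. The curve is smooth on every closed subinterval without interior
  break points, so all one-sided derivatives exist at the break points. The library's \<open>valid_path\<close>
  allows an unbounded derivative near a break point, hence a non-integrable speed, to which
  \<open>integral\<close> would assign the value 0.
\<close>

definition piecewise_smooth :: "(real \<Rightarrow> 'a::euclidean_space) \<Rightarrow> bool" where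
  "piecewise_smooth \<gamma> \<longleftrightarrow> continuous_on {0..1} \<gamma> \<and>
     (\<exists>P. finite P \<and> (\<forall>s t. 0 \<le> s \<and> s \<le> t \<and> t \<le> 1 \<and> {s<..<t} \<inter> P = {} \<longrightarrow> smooth_on {s..t} \<gamma>))"

definition finsler_length :: "('a::euclidean_space \<Rightarrow> 'a \<Rightarrow> real) \<Rightarrow> (real \<Rightarrow> 'a) \<Rightarrow> real" where
  "finsler_length F \<gamma> = integral {0..1} (\<lambda>t. F (\<gamma> t) (vector_derivative \<gamma> (at t within {0..1})))"

definition finsler_dist ::
  "'a::euclidean_space set \<Rightarrow> ('a \<Rightarrow> 'a \<Rightarrow> real) \<Rightarrow> 'a \<Rightarrow> 'a \<Rightarrow> real" where
  "finsler_dist M F x y = Inf {finsler_length F \<gamma> |\<gamma>.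
     piecewise_smooth \<gamma> \<and> path_image \<gamma> \<subseteq> M \<and> pathstart \<gamma> = x \<and> pathfinish \<gamma> = y}"

definition tangent_space :: "'a::euclidean_space set \<Rightarrow> 'a \<Rightarrow> 'a set" where
  "tangent_space M x = {w. \<exists>\<gamma> e. e > 0 \<and> smooth_on {-e<..<e} \<gamma> \<and> \<gamma> ` {-e<..<e} \<subseteq> M \<and>
     \<gamma> 0 = x \<and> (\<gamma> has_vector_derivative w) (at 0)}"

text \<open>
  Isometries are diffeomorphisms of \<open>M\<close> preserving \<open>F\<close>. The derivative \<open>D\<close> within \<open>M\<close> need not be
  unique as an ambient linear map, but its restriction to the tangent space is.
\<close>

definition finsler_isometry ::
  "'a::euclidean_space set \<Rightarrow> ('a \<Rightarrow> 'a \<Rightarrow> real) \<Rightarrow> ('a \<Rightarrow> 'a) \<Rightarrow> bool" where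
  "finsler_isometry M F \<rho> \<longleftrightarrow>
     bij_betw \<rho> M M \<and> smooth_on M \<rho> \<and> smooth_on M (inv_into M \<rho>) \<and>
     (\<forall>x\<in>M. \<exists>D. (\<rho> has_derivative D) (at x within M) \<and>
        (\<forall>w\<in>tangent_space M x. F (\<rho> x) (D w) = F x w))"

definition Clifford_Wolf_translation ::
  "'a::euclidean_space set \<Rightarrow> ('a \<Rightarrow> 'a \<Rightarrow> real) \<Rightarrow> ('a \<Rightarrow> 'a) \<Rightarrow> bool" where
  "Clifford_Wolf_translation M F \<rho> \<longleftrightarrow>
     finsler_isometry M F \<rho> \<and> (\<exists>L. \<forall>x\<in>M. finsler_dist M F x (\<rho> x) = L)"

definition Clifford_Wolf_homogeneous ::
  "'a::euclidean_space set \<Rightarrow> ('a \<Rightarrow> 'a \<Rightarrow> real) \<Rightarrow> bool" where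
  "Clifford_Wolf_homogeneous M F \<longleftrightarrow>
     (\<forall>x\<in>M. \<forall>y\<in>M. \<exists>\<sigma>. Clifford_Wolf_translation M F \<sigma> \<and> \<sigma> x = y)"

definition hermitian :: "complex^'m \<Rightarrow> complex^'m \<Rightarrow> complex" where
  "hermitian z w = (\<Sum>i\<in>UNIV. cnj (z $ i) * w $ i)"

text \<open>
  The norm on \<^typ>\<open>complex^'m\<close> is the Hermitian one. At a coordinate unit vector \<open>z\<close> and a tangent
  vector with component \<open>\<i> * q\<close> along \<open>z\<close> and orthogonal component \<open>u\<close>, the value is
  \<open>sqrt (a * q\<^sup>2 + b * (norm u)\<^sup>2) + c * q\<close>; \<open>randers_unitary\<close> and \<open>randers_axis\<close> below identify
  it with the invariant extension of that formula.
\<close>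

definition randers :: "real \<Rightarrow> real \<Rightarrow> real \<Rightarrow> complex^'m \<Rightarrow> complex^'m \<Rightarrow> real" where
  "randers a b c z w = (let q = Im (hermitian z w) in
     sqrt (a * q\<^sup>2 + b * (norm (w - (\<i> * complex_of_real q) *s z))\<^sup>2) + c * q)"

lemma hermitian_self: "hermitian z z = complex_of_real ((norm z)\<^sup>2)"
  by (simp add: hermitian_def norm_vec_def L2_set_def sum_nonneg mult.commute[of "cnj _"] flip: complex_norm_square)

lemma randers_unitary:
  fixes A :: "complex^'m^'m"
  assumes "\<And>x y. hermitian (A *v x) (A *v y) = hermitian x y"
  shows "randers a b c (A *v z) (A *v w) = randers a b c z w"
proof -
  have norm: "norm (A *v x) = norm x" for x
  proof -
    have "complex_of_real ((norm (A *v x))\<^sup>2) = complex_of_real ((norm x)\<^sup>2)"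
      using assms[of x x] by (simp only: hermitian_self)
    then show ?thesis by (metis norm_ge_zero of_real_eq_iff power2_eq_imp_eq)
  qed
  have "A *v w - k *s (A *v z) = A *v (w - k *s z)" for k
    by (simp add: matrix_vector_mult_diff_distrib vector_scalar_commute)
  then show ?thesis
    by (simp add: randers_def assms norm)
qed

lemma randers_axis:
  fixes u :: "complex^'m"
  assumes "u $ k = 0"
  shows "randers a b c (axis k 1) (u + axis k (\<i> * complex_of_real q))
    = sqrt (a * q\<^sup>2 + b * (norm u)\<^sup>2) + c * q"
proof -
  have "hermitian (axis k 1) (u + axis k (\<i> * complex_of_real q)) = \<i> * complex_of_real q"
    using assms by (simp add: hermitian_def axis_def if_distrib[of cnj] if_distrib[of "\<lambda>x. x * _"] cong: if_cong)
  moreover have "u + axis k (\<i> * complex_of_real q) - (\<i> * complex_of_real q) *s axis k 1 = u"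
    by (simp add: vec_eq_iff axis_def)
  ultimately show ?thesis
    by (simp add: randers_def)
qed

end

theory Submission
  imports Defs
begin

text \<open>
  When \<open>a = b + c\<^sup>2\<close>, the Randers metric solves Zermelo's navigation problem on the sphere with
  round metric \<open>1 / \<mu>\<^sup>2\<close> times the standard one and wind the Killing field \<open>z \<mapsto> \<i> \<nu> z\<close>, where
  \<open>\<mu> = sqrt a / b\<close> and \<open>\<nu> = -c / b\<close>. Hence the Finsler distance from \<open>x\<close> to \<open>y\<close> is the time \<open>T\<close>
  at which \<open>x\<close> and \<open>exp (-\<i> \<nu> T) y\<close> are at angle \<open>\<mu> T\<close>; it is unique because the wind is slower
  than \<open>\<mu>\<close>. Given such \<open>x\<close>, \<open>y\<close> and \<open>T\<close>, there is a unitary \<open>J\<close> with \<open>J\<^sup>2 = -1\<close> such that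
  \<open>\<sigma> = exp (\<i> \<nu> T) (cos (\<mu> T) + sin (\<mu> T) J)\<close> maps \<open>x\<close> to \<open>y\<close>. As \<open>z\<close> and \<open>J z\<close> are
  real-orthogonal for every \<open>z\<close>, the angle between \<open>z\<close> and \<open>exp (-\<i> \<nu> T) (\<sigma> z)\<close> is always \<open>\<mu> T\<close>,
  so \<open>\<sigma>\<close> moves every point by the distance \<open>T\<close>.
\<close>

section \<open>Angle against speed for curves on the unit sphere\<close>

text \<open>The factor \<open>r < 1\<close> in the proof keeps the argument of \<open>arccos\<close> away from \<open>\<plusminus>1\<close>, where it is
  not differentiable.\<close>

lemma arccos_inner_curve_le:
  fixes \<beta> :: "real \<Rightarrow> 'a::real_inner"
  assumes "s \<le> t" and x: "norm x = 1"
    and \<beta>: "\<And>p. p \<in> {s..t} \<Longrightarrow> norm (\<beta> p) = 1"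
    and d\<beta>: "\<And>p. p \<in> {s..t} \<Longrightarrow> (\<beta> has_vector_derivative \<beta>' p) (at p within {s..t})"
    and dl: "\<And>p. p \<in> {s..t} \<Longrightarrow> (l has_real_derivative l' p) (at p within {s..t})"
    and le: "\<And>p. p \<in> {s..t} \<Longrightarrow> norm (\<beta>' p) \<le> l' p"
  shows "arccos (x \<bullet> \<beta> t) - arccos (x \<bullet> \<beta> s) \<le> l t - l s"
proof -
  define u where "u p = x \<bullet> \<beta> p" for p
  have u1: "\<bar>u p\<bar> \<le> 1" if "p \<in> {s..t}" for p
    using Cauchy_Schwarz_ineq2[of x "\<beta> p"] \<beta>[OF that] x by (simp add: u_def)
  have cont\<beta>: "continuous_on {s..t} \<beta>"
    using d\<beta> by (rule continuous_on_vector_derivative)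
  have contl: "continuous_on {s..t} l"
    using dl by (rule DERIV_continuous_on)
  have step: "arccos (r * u t) - arccos (r * u s) \<le> l t - l s" if r: "r \<in> {0..<1}" for r
  proof -
    have ru: "\<bar>r * u p\<bar> < 1" if "p \<in> {s..t}" for p
    proof -
      have "\<bar>r * u p\<bar> = r * \<bar>u p\<bar>" using r by (simp add: abs_mult)
      also have "\<dots> \<le> r * 1" using u1[OF that] r by (intro mult_left_mono) auto
      finally show ?thesis using r by auto
    qed
    have "arccos (r * u t) - l t \<le> arccos (r * u s) - l s"
    proof (rule DERIV_nonpos_imp_decreasing_open[OF \<open>s \<le> t\<close>])
      fix p assume "s < p" "p < t"
      then have p: "p \<in> {s..t}" and at: "at p within {s..t} = at p"
        by (auto simp: at_within_Icc_at)
      have D\<beta>: "(\<beta> has_vector_derivative \<beta>' p) (at p)" and Dl: "(l has_real_derivative l' p) (at p)"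
        using d\<beta>[OF p] dl[OF p] by (simp_all add: at)
      have "((\<lambda>p. \<beta> p \<bullet> \<beta> p) has_vector_derivative (\<beta> p \<bullet> \<beta>' p + \<beta>' p \<bullet> \<beta> p)) (at p)"
        by (rule bounded_bilinear.has_vector_derivative[OF bounded_bilinear_inner D\<beta> D\<beta>])
      then have "((\<lambda>p. 1::real) has_vector_derivative (\<beta> p \<bullet> \<beta>' p + \<beta>' p \<bullet> \<beta> p)) (at p)"
        by (rule has_vector_derivative_transform_within_open[where S="{s<..<t}"])
          (use \<open>s < p\<close> \<open>p < t\<close> \<beta> in \<open>auto simp: dot_square_norm\<close>)
      then have orth: "\<beta> p \<bullet> \<beta>' p = 0"
        using vector_derivative_unique_at[OF _ has_vector_derivative_const] by (fastforce simp: inner_commute)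
      have Du: "(u has_real_derivative x \<bullet> \<beta>' p) (at p)"
        unfolding u_def has_real_derivative_iff_has_vector_derivative
        by (rule bounded_linear.has_vector_derivative[OF bounded_linear_inner_right D\<beta>])
      define D where "D = inverse (- sqrt (1 - (r * u p)\<^sup>2)) * (r * (x \<bullet> \<beta>' p)) - l' p"
      have "((\<lambda>p. arccos (r * u p) - l p) has_real_derivative D) (at p)"
        unfolding D_def
        by (rule DERIV_diff[OF DERIV_chain2[OF DERIV_arccos DERIV_cmult[OF Du]] Dl])
          (use ru[OF p] in auto)
      moreover have "D \<le> 0"
      proof -
        \<comment> \<open>As \<open>\<beta>' p\<close> is orthogonal to \<open>\<beta> p\<close>, it
          only sees the part of \<open>x\<close> orthogonal to \<open>\<beta> p\<close>. The length
          of that part, \<open>sqrt (1 - (u p)\<^sup>2)\<close>, is at most the denominator in the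
          derivative of \<open>arccos (r * u p)\<close>.\<close>
        have "(norm (x - u p *\<^sub>R \<beta> p))\<^sup>2 = 1 - (u p)\<^sup>2"
          using x \<beta>[OF p]
          unfolding power2_norm_eq_inner u_def norm_eq_1
          by (simp add: inner_diff inner_commute[of "\<beta> p" x] power2_eq_square)
        then have n: "norm (x - u p *\<^sub>R \<beta> p) = sqrt (1 - (u p)\<^sup>2)"
          by (metis norm_ge_zero real_sqrt_unique)
        have "\<bar>x \<bullet> \<beta>' p\<bar> = \<bar>(x - u p *\<^sub>R \<beta> p) \<bullet> \<beta>' p\<bar>"
          by (simp add: inner_diff orth)
        also have "\<dots> \<le> sqrt (1 - (u p)\<^sup>2) * norm (\<beta>' p)"
          using Cauchy_Schwarz_ineq2 n by metis
        also have "\<dots> \<le> sqrt (1 - (r * u p)\<^sup>2) * l' p"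
        proof (rule mult_mono)
          have "\<bar>r * u p\<bar> \<le> \<bar>u p\<bar>"
            using r by (simp add: abs_mult mult_left_le_one_le)
          then show "sqrt (1 - (u p)\<^sup>2) \<le> sqrt (1 - (r * u p)\<^sup>2)"
            by (simp add: abs_le_square_iff)
          show "0 \<le> sqrt (1 - (r * u p)\<^sup>2)"
            using ru[OF p] by (simp add: abs_square_le_1)
        qed (use le[OF p] in auto)
        finally have *: "\<bar>x \<bullet> \<beta>' p\<bar> \<le> sqrt (1 - (r * u p)\<^sup>2) * l' p" .
        have "- (r * (x \<bullet> \<beta>' p)) \<le> r * \<bar>x \<bullet> \<beta>' p\<bar>"
          using r mult_left_mono[of "- (x \<bullet> \<beta>' p)" "\<bar>x \<bullet> \<beta>' p\<bar>" r] by simp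
        also have "\<dots> \<le> 1 * \<bar>x \<bullet> \<beta>' p\<bar>"
          using r by (intro mult_right_mono) auto
        finally have "- (r * (x \<bullet> \<beta>' p)) \<le> sqrt (1 - (r * u p)\<^sup>2) * l' p" using * by simp
        moreover have "sqrt (1 - (r * u p)\<^sup>2) > 0"
          using ru[OF p] by (simp add: abs_square_less_1)
        ultimately show ?thesis
          unfolding D_def by (simp add: field_simps)
      qed
      ultimately show "\<exists>y. ((\<lambda>p. arccos (r * u p) - l p) has_real_derivative y) (at p) \<and> y \<le> 0"
        by blast
    next
      have "-1 \<le> r * u p \<and> r * u p \<le> 1" if "p \<in> {s..t}" for p
        using ru[OF that] by auto
      then show "continuous_on {s..t} (\<lambda>p. arccos (r * u p) - l p)"
        unfolding u_def by (intro continuous_intros cont\<beta> contl ballI) auto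
    qed
    then show ?thesis by simp
  qed
  have bnd: "-1 \<le> r * u p \<and> r * u p \<le> 1" if "r \<in> {0..1}" "p \<in> {s..t}" for r p
    using mult_mono[of "\<bar>r\<bar>" 1 "\<bar>u p\<bar>" 1] u1[OF that(2)] that(1)
    by (auto simp flip: abs_mult simp: abs_le_iff)
  \<comment> \<open>Limit as \<open>r\<close> tends to 1: the left side is continuous in
    \<open>r\<close> on \<open>{0..1}\<close>, the closure of \<open>{0..<1}\<close>, and the bound
    does not depend on \<open>r\<close>.\<close>
  have "arccos (1 * u t) - arccos (1 * u s) \<le> l t - l s"
  proof (rule continuous_le_on_closure[where S = "{0..<1}" and f = "\<lambda>r. arccos (r * u t) - arccos (r * u s)"])
    show "continuous_on (closure {0..<1}) (\<lambda>r. arccos (r * u t) - arccos (r * u s))"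
      using bnd \<open>s \<le> t\<close> by (intro continuous_intros ballI) auto
  qed (use step in auto)
  then show ?thesis by (simp add: u_def)
qed

section \<open>Continuous velocity of a smooth curve on a closed interval\<close>

text \<open>Smoothness only gives a different smooth extension near each point. Their derivatives
  all agree with the derivative within \<open>{s..t}\<close>, which is unique because
  \<open>s < t\<close>, and so fit together to one continuous velocity, including one-sided values
  at the ends.\<close>

lemma smooth_on_Icc_C1:
  fixes \<gamma> :: "real \<Rightarrow> 'a::euclidean_space"
  assumes "s < t" and sm: "smooth_on {s..t} \<gamma>"
  obtains v where "continuous_on {s..t} v"
    and "\<And>p. p \<in> {s..t} \<Longrightarrow> (\<gamma> has_vector_derivative v p) (at p within {s..t})"
proof
  define v where "v p = vector_derivative \<gamma> (at p within {s..t})" for p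
  have loc: "\<exists>e g'. e > 0 \<and> continuous (at p within {s..t}) g' \<and>
     (\<forall>y\<in>{s..t}. dist y p < e \<longrightarrow> (\<gamma> has_vector_derivative g' y) (at y within {s..t}))"
    if p: "p \<in> {s..t}" for p
  proof -
    obtain U g where U: "open U" "p \<in> U" and g: "\<forall>k. Ck_on k g U" "\<forall>y\<in>{s..t} \<inter> U. g y = \<gamma> y"
      using sm p unfolding smooth_on_def by blast
    define g' where "g' y = frechet_derivative g (at y) 1" for y
    have diff: "\<forall>y\<in>U. g differentiable (at y)" and cont: "continuous_on U g'"
      using g(1)[rule_format, of "Suc 0"] by (auto simp: g'_def)
    obtain e where e: "e > 0" "ball p e \<subseteq> U" using U by (meson openE)
    have "(\<gamma> has_vector_derivative g' y) (at y within {s..t})" if y: "y \<in> {s..t}" "dist y p < e" for y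
    proof -
      have yU: "y \<in> U" using e y by (auto simp: dist_commute)
      have lin: "linear (frechet_derivative g (at y))"
        using diff yU by (simp add: linear_frechet_derivative)
      have "(g has_derivative frechet_derivative g (at y)) (at y within {s..t})"
        using bspec[OF diff yU] unfolding frechet_derivative_works by (rule has_derivative_at_withinI)
      moreover have "frechet_derivative g (at y) = (\<lambda>h. h *\<^sub>R g' y)"
        unfolding g'_def by (metis lin linear_scale mult.right_neutral real_scaleR_def)
      ultimately have "(g has_vector_derivative g' y) (at y within {s..t})"
        by (simp add: has_vector_derivative_def)
      moreover obtain d where d: "d > 0" "ball y d \<subseteq> U" using U yU by (meson openE)
      moreover have "g x' = \<gamma> x'" if "x' \<in> {s..t}" "dist x' y < d" for x'
        using that g(2) d(2) by (metis IntI dist_commute mem_ball subsetD)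
      ultimately show ?thesis
        using has_vector_derivative_transform_within[OF _ d(1) y(1)] by metis
    qed
    moreover have "continuous (at p within {s..t}) g'"
      using cont U by (simp add: continuous_on_eq_continuous_at continuous_at_imp_continuous_at_within)
    ultimately show ?thesis using \<open>e > 0\<close> by blast
  qed
  show D: "(\<gamma> has_vector_derivative v p) (at p within {s..t})" if "p \<in> {s..t}" for p
  proof -
    have "\<exists>d. (\<gamma> has_vector_derivative d) (at p within {s..t})"
      using loc[OF that] that by (metis dist_self)
    then show ?thesis
      unfolding v_def using differentiableI_vector vector_derivative_works by blast
  qed
  show "continuous_on {s..t} v"
    unfolding continuous_on_eq_continuous_within
  proof
    fix p assume p: "p \<in> {s..t}"
    obtain e g' where e: "e > 0" and cont: "continuous (at p within {s..t}) g'"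
      and g': "\<forall>y\<in>{s..t}. dist y p < e \<longrightarrow> (\<gamma> has_vector_derivative g' y) (at y within {s..t})"
      using loc[OF p] by blast
    have "g' y = v y" if "y \<in> {s..t}" "dist y p < e" for y
      using vector_derivative_within_closed_interval[of s t y \<gamma> "g' y"] g' that \<open>s < t\<close>
      by (auto simp: v_def)
    then show "continuous (at p within {s..t}) v"
      using continuous_transform_within[OF cont e p] by blast
  qed
qed

section \<open>Hermitian algebra and phase factors\<close>

lemma inner_eq_Re_hermitian: "x \<bullet> y = Re (hermitian x y)"
  by (simp add: inner_vec_def hermitian_def inner_complex_def)

lemma cnj_hermitian: "cnj (hermitian z w) = hermitian w z"
  by (simp add: hermitian_def mult.commute)

lemma hermitian_add_left: "hermitian (x + y) z = hermitian x z + hermitian y z"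
  by (simp add: hermitian_def algebra_simps sum.distrib)

lemma hermitian_add_right: "hermitian x (y + z) = hermitian x y + hermitian x z"
  by (simp add: hermitian_def algebra_simps sum.distrib)

lemma hermitian_diff_left: "hermitian (x - y) z = hermitian x z - hermitian y z"
  by (simp add: hermitian_def algebra_simps sum_subtractf)

lemma hermitian_diff_right: "hermitian x (y - z) = hermitian x y - hermitian x z"
  by (simp add: hermitian_def algebra_simps sum_subtractf)

lemma hermitian_scale_left: "hermitian (k *s x) y = cnj k * hermitian x y"
  by (simp add: hermitian_def sum_distrib_left mult.assoc)

lemma hermitian_scale_right: "hermitian x (k *s y) = k * hermitian x y"
  by (simp add: hermitian_def sum_distrib_left algebra_simps)

lemmas hermitian_simps = hermitian_add_left hermitian_add_right hermitian_diff_left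
  hermitian_diff_right hermitian_scale_left hermitian_scale_right

lemma norm_vector_scalar_mult: "norm (k *s z) = cmod k * norm z" for z :: "complex^'m"
  by (simp add: norm_vec_def norm_mult L2_set_right_distrib)

lemma scaleR_eq_vector_scalar_mult: "r *\<^sub>R z = complex_of_real r *s z" for z :: "complex^'m"
  by (simp add: vec_eq_iff scaleR_conv_of_real[where 'a=complex])

lemma bounded_bilinear_vector_scalar_mult:
  "bounded_bilinear ((*s) :: complex \<Rightarrow> complex^'m \<Rightarrow> complex^'m)"
  by (rule bounded_bilinear.intro)
    (auto simp: vec_eq_iff algebra_simps norm_vector_scalar_mult intro!: exI[of _ 1])

text \<open>\<open>Im (hermitian z w)\<close> is the real inner product of \<open>w\<close> with
  \<open>\<i> *s z\<close>, so this is the expansion of a square.\<close>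

lemma norm_diff_imaginary_scale:
  fixes z w :: "complex^'m"
  assumes "norm z = 1"
  shows "(norm (w - (\<i> * complex_of_real s) *s z))\<^sup>2 = (norm w)\<^sup>2 - 2 * s * Im (hermitian z w) + s\<^sup>2"
proof -
  have "w \<bullet> ((\<i> * complex_of_real s) *s z) = s * Im (hermitian z w)"
    unfolding inner_commute[of w] by (simp add: inner_eq_Re_hermitian hermitian_simps)
  moreover have "(norm ((\<i> * complex_of_real s) *s z))\<^sup>2 = s\<^sup>2"
    using assms by (simp add: norm_vector_scalar_mult norm_mult)
  ultimately show ?thesis
    by (simp add: power2_norm_eq_inner inner_diff inner_commute)
qed

text \<open>The phase is factored out of the whole derivative so that it disappears under the
  norm.\<close>

lemma has_vector_derivative_cis_scale:
  fixes z :: "real \<Rightarrow> complex^'m"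
  assumes "(f has_real_derivative f') (at p within S)" and "(z has_vector_derivative z') (at p within S)"
  shows "((\<lambda>p. cis (f p) *s z p) has_vector_derivative
    cis (f p) *s (z' + (\<i> * complex_of_real f') *s z p)) (at p within S)"
proof -
  have "((\<lambda>p. cis (f p)) has_vector_derivative \<i> * complex_of_real f' * cis (f p)) (at p within S)"
    using has_derivative_cis[OF has_field_derivative_imp_has_derivative[OF assms(1)]]
    by (simp add: has_vector_derivative_def scaleR_conv_of_real ac_simps)
  from bounded_bilinear.has_vector_derivative[OF bounded_bilinear_vector_scalar_mult this assms(2)]
  show ?thesis
    by (rule back_subst[where P = "\<lambda>d. (_ has_vector_derivative d) _"]) (simp add: vec_eq_iff algebra_simps)
qed

lemma continuous_on_randers:
  fixes z w :: "real \<Rightarrow> complex^'m"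
  assumes "continuous_on S z" "continuous_on S w"
  shows "continuous_on S (\<lambda>p. randers a b c (z p) (w p))"
  unfolding randers_def Let_def hermitian_def vector_scalar_mult_def
  by (intro continuous_intros assms)

section \<open>Navigation form of the Randers metric\<close>

locale zermelo_randers =
  fixes a b c :: real
  assumes b: "b > 0" and a: "a = b + c\<^sup>2"
begin

text \<open>Zermelo data: the unit sphere of \<^term>\<open>randers a b c z\<close> is the round sphere of radius \<open>\<mu>\<close>
  about the wind \<open>\<i> * \<nu> * z\<close>.\<close>

definition \<mu> where "\<mu> = sqrt a / b"
definition \<nu> where "\<nu> = - c / b"

lemma a_pos: "a > 0"
  unfolding a using b by (simp add: add_pos_nonneg)

lemma \<mu>_pos: "\<mu> > 0"
  using b a_pos by (simp add: \<mu>_def)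

text \<open>Amounts to \<open>\<bar>c\<bar> < sqrt a\<close>, which follows from
  \<open>b > 0\<close>. Its strictness gives the contradiction that bounds the distance from
  below.\<close>

lemma wind_slow: "\<bar>\<nu>\<bar> < \<mu>"
proof -
  have "\<bar>c\<bar> < sqrt a"
    using b a by (intro real_less_rsqrt) simp
  then show ?thesis
    using b by (simp add: \<mu>_def \<nu>_def divide_strict_right_mono)
qed

lemma \<mu>_sq: "\<mu>\<^sup>2 = 1 / b + \<nu>\<^sup>2"
proof -
  have "\<mu>\<^sup>2 = a / b\<^sup>2"
    using a_pos by (simp add: \<mu>_def power_divide)
  then show ?thesis
    using b by (simp only: \<nu>_def a) (simp add: field_simps power2_eq_square)
qed

text \<open>With \<open>q = Im (hermitian z w)\<close>, the orthogonal component has squared norm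
  \<open>(norm w)\<^sup>2 - q\<^sup>2\<close>, and \<open>a - b = c\<^sup>2\<close> turns the
  remaining multiple of \<open>q\<^sup>2\<close> into \<open>(c * q)\<^sup>2\<close>.\<close>

lemma randers_sphere:
  assumes "norm z = 1"
  shows "randers a b c z w
    = sqrt (b * (norm w)\<^sup>2 + (c * Im (hermitian z w))\<^sup>2) + c * Im (hermitian z w)"
proof -
  have "a * q\<^sup>2 + b * ((norm w)\<^sup>2 - 2 * q * q + q\<^sup>2) = b * (norm w)\<^sup>2 + (c * q)\<^sup>2" for q
    by (simp add: a algebra_simps power2_eq_square)
  then show ?thesis
    by (simp add: randers_def Let_def norm_diff_imaginary_scale[OF assms])
qed

text \<open>After squaring, the terms \<open>\<nu>\<^sup>2 * T\<^sup>2\<close> cancel by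
  \<open>\<mu>_sq\<close>. What remains is a quadratic equation in \<open>T\<close> whose
  nonnegative root is the Randers norm of \<open>w\<close>.\<close>

lemma wind_speed_iff:
  fixes z w :: "complex^'m"
  assumes "norm z = 1" and "T \<ge> 0"
  shows "norm (w - (\<i> * complex_of_real (\<nu> * T)) *s z) = \<mu> * T
    \<longleftrightarrow> T\<^sup>2 - 2 * c * Im (hermitian z w) * T = b * (norm w)\<^sup>2"
proof -
  define q where "q = Im (hermitian z w)"
  have "norm (w - (\<i> * complex_of_real (\<nu> * T)) *s z) = \<mu> * T
    \<longleftrightarrow> (norm (w - (\<i> * complex_of_real (\<nu> * T)) *s z))\<^sup>2 = (\<mu> * T)\<^sup>2"
    using assms(2) \<mu>_pos by simp
  also have "\<dots> \<longleftrightarrow> (norm w)\<^sup>2 - 2 * (\<nu> * T) * q + (\<nu> * T)\<^sup>2 = (1 / b + \<nu>\<^sup>2) * T\<^sup>2"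
    by (simp only: norm_diff_imaginary_scale[OF assms(1)] power_mult_distrib[of \<mu>] \<mu>_sq q_def)
  also have "\<dots> \<longleftrightarrow> (norm w)\<^sup>2 + 2 * c * q * T / b = T\<^sup>2 / b"
    by (simp add: \<nu>_def algebra_simps power_mult_distrib power_divide)
  also have "\<dots> \<longleftrightarrow> T\<^sup>2 - 2 * c * q * T = b * (norm w)\<^sup>2"
    using b by (auto simp: field_simps)
  finally show ?thesis by (simp add: q_def)
qed

lemma randers_nonneg:
  assumes "norm z = 1"
  shows "randers a b c z w \<ge> 0"
proof -
  have "\<bar>c * Im (hermitian z w)\<bar> \<le> sqrt (b * (norm w)\<^sup>2 + (c * Im (hermitian z w))\<^sup>2)"
    using b by (intro real_le_rsqrt) simp
  then show ?thesis
    unfolding randers_sphere[OF assms] by linarith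
qed

text \<open>With \<open>S\<close> the square root in the metric, \<open>T = S + c * q\<close> solves
  the quadratic equation, since its left side becomes
  \<open>S\<^sup>2 - (c * q)\<^sup>2\<close>.\<close>

lemma randers_wind_speed:
  assumes "norm z = 1"
  shows "norm (w - (\<i> * complex_of_real (\<nu> * randers a b c z w)) *s z) = \<mu> * randers a b c z w"
proof -
  define q where "q = Im (hermitian z w)"
  define S where "S = sqrt (b * (norm w)\<^sup>2 + (c * q)\<^sup>2)"
  have S: "S\<^sup>2 = b * (norm w)\<^sup>2 + (c * q)\<^sup>2"
    using b by (simp add: S_def)
  have R: "randers a b c z w = S + c * q"
    by (simp add: randers_sphere[OF assms] S_def q_def)
  have "(S + c * q)\<^sup>2 - 2 * c * q * (S + c * q) = b * (norm w)\<^sup>2"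
    using S by (simp add: power2_eq_square algebra_simps)
  then show ?thesis
    unfolding wind_speed_iff[OF assms randers_nonneg[OF assms]] by (simp add: R q_def)
qed

lemma randers_eqI:
  assumes z: "norm z = 1" and "T \<ge> 0"
    and "norm (w - (\<i> * complex_of_real (\<nu> * T)) *s z) = \<mu> * T"
  shows "randers a b c z w = T"
proof -
  define q where "q = Im (hermitian z w)"
  have e: "T\<^sup>2 - 2 * c * q * T = b * (norm w)\<^sup>2"
    using assms wind_speed_iff by (auto simp: q_def)
  \<comment> \<open>Selects the branch of the square root of \<open>(T - c * q)\<^sup>2\<close>. For
    \<open>T > 0\<close> the equation gives \<open>T * (T - 2 * (c * q)) \<ge> 0\<close>, so
    \<open>c * q \<le> T / 2\<close>.\<close>
  have "T - c * q \<ge> 0"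
  proof (cases "T = 0")
    case True
    then have "w = 0" using e b by simp
    then show ?thesis by (simp add: True q_def hermitian_def)
  next
    case False
    have "T * (T - 2 * (c * q)) \<ge> 0"
      using e b by (simp add: power2_eq_square algebra_simps)
    then have "T - 2 * (c * q) \<ge> 0"
      using False \<open>T \<ge> 0\<close> by (simp add: zero_le_mult_iff)
    then show ?thesis using \<open>T \<ge> 0\<close> by linarith
  qed
  moreover have "b * (norm w)\<^sup>2 + (c * q)\<^sup>2 = (T - c * q)\<^sup>2"
    using e by (simp add: power2_eq_square algebra_simps)
  ultimately show ?thesis
    by (simp add: randers_sphere[OF z] flip: q_def)
qed

text \<open>Flowing the curve back along the wind by its Finsler arc length turns it into a curve of
  Euclidean speed \<open>\<mu>\<close> times its Finsler speed.\<close>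

lemma arccos_randers_piece_le:
  fixes \<gamma> :: "real \<Rightarrow> complex^'m"
  assumes "s \<le> t" and x: "norm x = 1"
    and \<gamma>: "\<And>p. p \<in> {s..t} \<Longrightarrow> norm (\<gamma> p) = 1"
    and d\<gamma>: "\<And>p. p \<in> {s..t} \<Longrightarrow> (\<gamma> has_vector_derivative v p) (at p within {s..t})"
    and v: "continuous_on {s..t} v"
  defines "L p \<equiv> integral {s..p} (\<lambda>p. randers a b c (\<gamma> p) (v p))"
  shows "arccos (x \<bullet> (cis (- \<nu> * (\<tau> + L t)) *s \<gamma> t))
    \<le> arccos (x \<bullet> (cis (- \<nu> * \<tau>) *s \<gamma> s)) + \<mu> * L t"
proof -
  define f where "f p = randers a b c (\<gamma> p) (v p)" for p
  \<comment> \<open>\<open>\<tau>\<close> stands for the time spent before this piece; keeping it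
    arbitrary allows consecutive pieces to be chained.\<close>
  define \<beta> where "\<beta> p = cis (- \<nu> * (\<tau> + L p)) *s \<gamma> p" for p
  define \<beta>' where "\<beta>' p = cis (- \<nu> * (\<tau> + L p)) *s (v p + (\<i> * complex_of_real (- \<nu> * f p)) *s \<gamma> p)" for p
  have contf: "continuous_on {s..t} f"
    unfolding f_def using d\<gamma> v by (blast intro: continuous_on_randers continuous_on_vector_derivative)
  have dL: "(L has_real_derivative f p) (at p within {s..t})" if "p \<in> {s..t}" for p
    using integral_has_real_derivative[OF contf that] by (simp add: L_def[abs_def] f_def[abs_def])
  have "arccos (x \<bullet> \<beta> t) - arccos (x \<bullet> \<beta> s) \<le> \<mu> * L t - \<mu> * L s"
  proof (rule arccos_inner_curve_le[OF \<open>s \<le> t\<close> x, where \<beta>' = \<beta>' and l' = "\<lambda>p. \<mu> * f p"])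
    fix p assume p: "p \<in> {s..t}"
    show "norm (\<beta> p) = 1" using \<gamma>[OF p] by (simp add: \<beta>_def norm_vector_scalar_mult)
    have "((\<lambda>p. - \<nu> * (\<tau> + L p)) has_real_derivative - \<nu> * f p) (at p within {s..t})"
      using dL[OF p] by (auto intro!: derivative_eq_intros)
    from has_vector_derivative_cis_scale[OF this d\<gamma>[OF p]]
    show "(\<beta> has_vector_derivative \<beta>' p) (at p within {s..t})"
      by (simp add: \<beta>_def[abs_def] \<beta>'_def)
    show "((\<lambda>p. \<mu> * L p) has_real_derivative \<mu> * f p) (at p within {s..t})"
      using dL[OF p] by (rule DERIV_cmult)
    have "norm (\<beta>' p) = norm (v p - (\<i> * complex_of_real (\<nu> * f p)) *s \<gamma> p)"
      unfolding \<beta>'_def norm_vector_scalar_mult by simp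
    then show "norm (\<beta>' p) \<le> \<mu> * f p"
      using randers_wind_speed[OF \<gamma>[OF p]] by (simp add: f_def)
  qed
  then show ?thesis by (simp add: \<beta>_def L_def)
qed

end

section \<open>Subdivision at break points\<close>

text \<open>Induction on the number of break points strictly inside the interval: cutting at one of
  them leaves fewer on either side. It carries statements from smooth pieces to a whole
  curve.\<close>

lemma interval_subdivision_induct [consumes 3, case_names refl piece join]:
  fixes Q :: "real \<Rightarrow> real \<Rightarrow> bool"
  assumes "finite P" "s \<le> t" and "{s..t} \<subseteq> {l..u}"
    and refl: "\<And>s. s \<in> {l..u} \<Longrightarrow> Q s s"
    and piece: "\<And>s t. \<lbrakk>l \<le> s; s < t; t \<le> u; {s<..<t} \<inter> P = {}\<rbrakk> \<Longrightarrow> Q s t"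
    and join: "\<And>r s t. \<lbrakk>l \<le> r; r < s; s < t; t \<le> u; Q r s; Q s t\<rbrakk> \<Longrightarrow> Q r t"
  shows "Q s t"
  using assms(2,3)
proof (induction "card (P \<inter> {s<..<t})" arbitrary: s t rule: less_induct)
  case less
  show ?case
  proof (cases "s = t \<or> {s<..<t} \<inter> P = {}")
    case True
    then show ?thesis using less.prems refl piece[of s t] by fastforce
  next
    case False
    then obtain p where p: "p \<in> P" "s < p" "p < t" by auto
    have "P \<inter> {s<..<p} \<subset> P \<inter> {s<..<t}" "P \<inter> {p<..<t} \<subset> P \<inter> {s<..<t}"
      using p by auto
    then have "card (P \<inter> {s<..<p}) < card (P \<inter> {s<..<t})" "card (P \<inter> {p<..<t}) < card (P \<inter> {s<..<t})"
      using \<open>finite P\<close> by (simp_all add: psubset_card_mono)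
    then have "Q s p" "Q p t"
      using less p by auto
    then show ?thesis
      using join[of s p t] p less.prems by auto
  qed
qed

section \<open>Smoothness of linear maps and trigonometric curves\<close>

lemma Ck_on_const: "Ck_on k (\<lambda>x. z) U"
  by (induction k arbitrary: z) auto

lemma Ck_on_bounded_linear:
  assumes "bounded_linear f"
  shows "Ck_on k f U"
proof (cases k)
  case 0
  then show ?thesis using assms by (simp add: linear_continuous_on)
next
  case (Suc k')
  have "(f has_derivative f) (at x)" for x
    using assms by (rule bounded_linear_imp_has_derivative)
  then show ?thesis
    using Suc frechet_derivative_at[of f f] by (auto simp: differentiable_def Ck_on_const)
qed

text \<open>Differentiation keeps both frequencies and only multiplies \<open>p\<close> and
  \<open>q\<close> by scalars, so the induction runs over all coefficients at once. Great circles
  carried by the wind have this form.\<close>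

lemma Ck_on_cis_scale_sum:
  fixes p q :: "complex^'m"
  shows "Ck_on k (\<lambda>t::real. cis (\<alpha> * t) *s p + cis (\<beta> * t) *s q) U"
proof (induction k arbitrary: p q)
  have D: "((\<lambda>t. cis (\<alpha> * t) *s p) has_vector_derivative cis (\<alpha> * t) *s ((\<i> * complex_of_real \<alpha>) *s p)) (at t)"
    for t \<alpha> and p :: "complex^'m"
    using has_vector_derivative_cis_scale[of "\<lambda>t. \<alpha> * t" \<alpha> t UNIV "\<lambda>_. p" 0]
    by (auto intro!: derivative_eq_intros)
  have D: "((\<lambda>t. cis (\<alpha> * t) *s p + cis (\<beta> * t) *s q) has_derivative
      (\<lambda>h. h *\<^sub>R (cis (\<alpha> * t) *s ((\<i> * complex_of_real \<alpha>) *s p) + cis (\<beta> * t) *s ((\<i> * complex_of_real \<beta>) *s q)))) (at t)"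
    for t and p q :: "complex^'m"
    unfolding has_vector_derivative_def[symmetric] by (intro has_vector_derivative_add D)
  {
    case 0
    show ?case
      unfolding Ck_on.simps by (rule has_derivative_continuous_on) (rule has_derivative_at_withinI[OF D])
  next
    case (Suc k)
    have eq: "frechet_derivative (\<lambda>t. cis (\<alpha> * t) *s p + cis (\<beta> * t) *s q) (at t) v
      = cis (\<alpha> * t) *s ((v * (\<i> * complex_of_real \<alpha>)) *s p) + cis (\<beta> * t) *s ((v * (\<i> * complex_of_real \<beta>)) *s q)" for t v
      unfolding frechet_derivative_at[OF D, symmetric]
      unfolding scaleR_eq_vector_scalar_mult by (simp add: vec_eq_iff algebra_simps)
    have "Ck_on k (\<lambda>t. frechet_derivative (\<lambda>t. cis (\<alpha> * t) *s p + cis (\<beta> * t) *s q) (at t) v) U" for v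
      unfolding eq by (rule Suc)
    moreover have "(\<lambda>t. cis (\<alpha> * t) *s p + cis (\<beta> * t) *s q) differentiable (at t)" for t
      using D differentiable_def by blast
    ultimately show ?case
      by simp
  }
qed

section \<open>Unitary complex structures and unitary isometries\<close>

lemma inner_imaginary_scale_self: "x \<bullet> (\<i> *s x) = 0" for x :: "complex^'m"
  unfolding inner_eq_Re_hermitian by (simp add: hermitian_simps hermitian_self)

text \<open>\<open>J\<close> is \<open>\<i>\<close> times the unitary reflection that exchanges \<open>x\<close> and \<open>-\<i> v\<close>; it exists because
  \<^term>\<open>hermitian x ((- \<i>) *s v)\<close> is real. For \<open>v = \<i> x\<close> the division by zero
  yields the identity in place of the reflection, as needed.\<close>

lemma obtain_unitary_complex_structure:
  fixes x v :: "complex^'m"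
  assumes x: "norm x = 1" and v: "norm v = 1" and orth: "x \<bullet> v = 0"
  obtains J where "\<And>y z. J (y + z) = J y + J z" and "\<And>k z. J (k *s z) = k *s J z"
    and "\<And>y z. hermitian (J y) (J z) = hermitian y z"
    and "\<And>y z. hermitian (J y) z = - hermitian y (J z)"
    and "J x = v"
proof -
  define h where "h = (- \<i>) *s v"
  define d where "d = x - h"
  define r where "r = 2 / complex_of_real ((norm d)\<^sup>2)"
  define H where "H z = z - (r * hermitian d z) *s d" for z
  have r: "cnj r = r" by (simp add: r_def)
  have dd: "hermitian d d = complex_of_real ((norm d)\<^sup>2)" by (rule hermitian_self)
  \<comment> \<open>Covers \<open>d = 0\<close> too, where \<open>r = 2 / 0 = 0\<close>.\<close>
  have rdd: "r * r * hermitian d d = 2 * r"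
    unfolding dd r_def by (cases "complex_of_real ((norm d)\<^sup>2) = 0") (simp_all del: of_real_power)
  have add: "H (y + z) = H y + H z" and scale: "H (k *s z) = k *s H z" for y z k
    by (simp_all add: H_def hermitian_simps vec_eq_iff algebra_simps)
  have sym: "hermitian (H y) z = hermitian y (H z)" for y z
    by (simp add: H_def hermitian_simps r cnj_hermitian)
  have iso: "hermitian (H y) (H z) = hermitian y z" for y z
  proof -
    have "hermitian (H y) (H z) = hermitian y z - 2 * r * (hermitian y d * hermitian d z)
      + (r * r * hermitian d d) * (hermitian y d * hermitian d z)"
      by (simp add: H_def hermitian_simps r cnj_hermitian algebra_simps)
    then show ?thesis by (simp add: rdd)
  qed
  \<comment> \<open>A self-adjoint isometry is an involution, stated here inside the Hermitian
    product.\<close>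
  then have HH: "hermitian y (H (H z)) = hermitian y z" for y z
    using sym by metis
  have Hx: "H x = h"
  proof (cases "d = 0")
    case True
    then show ?thesis by (simp add: H_def d_def)
  next
    case False
    define \<kappa> where "\<kappa> = hermitian x h"
    have h1: "norm h = 1" using v by (simp add: h_def norm_vector_scalar_mult)
    have "Im \<kappa> = 0"
      using orth unfolding \<kappa>_def h_def hermitian_simps inner_eq_Re_hermitian by simp
    then have \<kappa>: "hermitian h x = \<kappa>"
      using cnj_hermitian[of x h] by (simp add: \<kappa>_def complex_eq_iff)
    have "hermitian x x = 1" "hermitian h h = 1"
      using x h1 by (simp_all add: hermitian_self)
    then have "hermitian d d = 2 * hermitian d x"
      using \<kappa> by (simp add: d_def hermitian_simps \<kappa>_def)
    moreover have "hermitian d d \<noteq> 0" using False by (simp add: dd)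
    ultimately have "r * hermitian d x = 1"
      unfolding r_def dd[symmetric] by simp
    then show ?thesis by (simp add: H_def d_def)
  qed
  show thesis
  \<comment> \<open>The factor \<open>\<i>\<close> turns the self-adjoint \<open>H\<close> into a
    skew-adjoint map and keeps it isometric.\<close>
  proof (rule that[of "\<lambda>z. \<i> *s H z"])
    show "\<i> *s H x = v" by (simp add: Hx h_def vec_eq_iff)
  qed (simp_all add: add scale sym HH hermitian_simps vec_eq_iff algebra_simps)
qed

text \<open>The real part of \<open>iso\<close> makes \<open>f\<close> orthogonal, hence bijective
  with linear inverse. So \<open>f\<close> and \<open>inv f\<close> are the smooth extensions
  required, \<open>f\<close> is its own derivative, and \<open>randers\<close> is built only from
  operations that \<open>f\<close> respects.\<close>

lemma unitary_finsler_isometry: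
  fixes f :: "complex^'m \<Rightarrow> complex^'m"
  assumes add: "\<And>y z. f (y + z) = f y + f z" and scale: "\<And>k z. f (k *s z) = k *s f z"
    and iso: "\<And>y z. hermitian (f y) (f z) = hermitian y z"
  shows "finsler_isometry (sphere 0 1) (randers a b c) f"
proof -
  have lin: "linear f"
    by (rule linearI) (simp_all add: add scale scaleR_eq_vector_scalar_mult)
  have orth: "orthogonal_transformation f"
    unfolding orthogonal_transformation_def by (simp add: lin inner_eq_Re_hermitian iso)
  have inv_orth: "orthogonal_transformation (inv f)"
    by (rule orthogonal_transformation_inv[OF orth])
  have nf: "norm (f z) = norm z" for z
    using orth by (rule orthogonal_transformation_norm)
  have ninv: "norm (inv f z) = norm z" for z
    using inv_orth by (rule orthogonal_transformation_norm)
  have bij: "bij f" by (rule orthogonal_transformation_bij[OF orth])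
  have inv: "f (inv f z) = z" "inv f (f z) = z" for z
    using bij by (simp_all add: bij_is_surj surj_f_inv_f bij_is_inj)
  have bb: "bij_betw f (sphere 0 1) (sphere 0 1)"
    by (rule bij_betw_byWitness[where f' = "inv f"]) (auto simp: inv nf ninv)
  have invS: "inv_into (sphere 0 1) f z = inv f z" if "z \<in> sphere 0 1" for z
    using that by (intro inv_into_f_eq bij_betw_imp_inj_on[OF bb]) (auto simp: inv ninv)
  have bl: "bounded_linear f" "bounded_linear (inv f)"
    using lin inv_orth linear_conv_bounded_linear orthogonal_transformation_linear by blast+
  have S: "smooth_on (sphere 0 1) f" "smooth_on (sphere 0 1) (inv_into (sphere 0 1) f)"
    unfolding smooth_on_def
    using Ck_on_bounded_linear[OF bl(1)] Ck_on_bounded_linear[OF bl(2)] invS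
    by (metis IntD1 UNIV_I open_UNIV)+
  have diff: "f (y - k *s z) = f y - k *s f z" for y z k
    using linear_diff[OF lin] scale by simp
  have "randers a b c (f z) (f w) = randers a b c z w" for z w
    unfolding randers_def Let_def by (simp add: iso nf flip: diff)
  moreover have "(f has_derivative f) (at z within sphere 0 1)" for z
    using bl(1) by (rule bounded_linear_imp_has_derivative)
  ultimately show ?thesis
    unfolding finsler_isometry_def using bb S by blast
qed

section \<open>Finsler lengths and distances\<close>

context zermelo_randers
begin

text \<open>Chains the estimate for one smooth piece along a subdivision. It serves to bound the
  length of every competing curve from below.\<close>

lemma arccos_randers_length_le:
  fixes \<gamma> :: "real \<Rightarrow> complex^'m"
  assumes sm: "piecewise_smooth \<gamma>" and sub: "path_image \<gamma> \<subseteq> sphere 0 1" and x: "norm x = 1"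
  defines "l \<equiv> finsler_length (randers a b c) \<gamma>"
  shows "arccos (x \<bullet> (cis (- \<nu> * l) *s pathfinish \<gamma>)) \<le> arccos (x \<bullet> pathstart \<gamma>) + \<mu> * l"
proof -
  define f where "f t = randers a b c (\<gamma> t) (vector_derivative \<gamma> (at t within {0..1}))" for t
  have \<gamma>: "norm (\<gamma> p) = 1" if "p \<in> {0..1}" for p
    using sub that by (simp add: path_image_def image_subset_iff)
  obtain P where P: "finite P"
    and smP: "\<And>s t. 0 \<le> s \<Longrightarrow> s \<le> t \<Longrightarrow> t \<le> 1 \<Longrightarrow> {s<..<t} \<inter> P = {} \<Longrightarrow> smooth_on {s..t} \<gamma>"
    using sm unfolding piecewise_smooth_def by metis
  \<comment> \<open>\<open>\<tau>\<close> is quantified because a second piece starts when the clock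
    already shows the length of the first. Integrability is carried along for the additivity of
    \<open>integral\<close>.\<close>
  have "f integrable_on {0..1} \<and> (\<forall>\<tau>. arccos (x \<bullet> (cis (- \<nu> * (\<tau> + integral {0..1} f)) *s \<gamma> 1))
    \<le> arccos (x \<bullet> (cis (- \<nu> * \<tau>) *s \<gamma> 0)) + \<mu> * integral {0..1} f)"
    using P zero_le_one order_refl
  proof (induction rule: interval_subdivision_induct[where l = 0 and u = 1])
    case (refl s)
    then show ?case using integrable_on_refl[of f s] by simp
  next
    case (piece s t)
    obtain v where v: "continuous_on {s..t} v"
      and d\<gamma>: "\<And>p. p \<in> {s..t} \<Longrightarrow> (\<gamma> has_vector_derivative v p) (at p within {s..t})"
      using smooth_on_Icc_C1[OF \<open>s < t\<close> smP] piece by auto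
    define g where "g p = randers a b c (\<gamma> p) (v p)" for p
    have "continuous_on {s..t} \<gamma>"
      using d\<gamma> by (rule continuous_on_vector_derivative)
    then have g: "g integrable_on {s..t}"
      unfolding g_def by (intro integrable_continuous_real continuous_on_randers v)
    \<comment> \<open>At \<open>s\<close> and \<open>t\<close> the curve may have corners, where the
      derivative within \<open>{0..1}\<close> need not equal \<open>v\<close>; two points do not
      change the integral.\<close>
    have fg: "f p = g p" if "p \<in> {s..t} - {s, t}" for p
    proof -
      have "at p within {s..t} = at p" "at p within {0..1} = at p"
        using that piece by (auto simp: at_within_Icc_at)
      then show ?thesis
        using d\<gamma>[of p] that by (simp add: f_def g_def vector_derivative_at)
    qed
    have f: "f integrable_on {s..t}"
      using integrable_spike_finite[of "{s, t}", OF _ fg g] by simp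
    have "integral {s..t} f = integral {s..t} g"
      using fg by (intro integral_spike[of "{s, t}"]) (auto simp: negligible_finite)
    moreover have "arccos (x \<bullet> (cis (- \<nu> * (\<tau> + integral {s..t} g)) *s \<gamma> t))
      \<le> arccos (x \<bullet> (cis (- \<nu> * \<tau>) *s \<gamma> s)) + \<mu> * integral {s..t} g" for \<tau>
      unfolding g_def
      by (rule arccos_randers_piece_le[OF _ x _ d\<gamma> v]) (use \<gamma> piece in auto)
    ultimately show ?case using f by simp
  next
    case (join r s t)
    then have f: "f integrable_on {r..t}" and e: "integral {r..t} f = integral {r..s} f + integral {s..t} f"
      using Henstock_Kurzweil_Integration.integrable_combine[of r s t f]
        Henstock_Kurzweil_Integration.integral_combine[of r s t f] by auto
    have "arccos (x \<bullet> (cis (- \<nu> * (\<tau> + integral {r..t} f)) *s \<gamma> t))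
      \<le> arccos (x \<bullet> (cis (- \<nu> * \<tau>) *s \<gamma> r)) + \<mu> * integral {r..t} f" for \<tau>
    proof -
      have "arccos (x \<bullet> (cis (- \<nu> * (\<tau> + integral {r..s} f)) *s \<gamma> s))
        \<le> arccos (x \<bullet> (cis (- \<nu> * \<tau>) *s \<gamma> r)) + \<mu> * integral {r..s} f"
        using join by blast
      moreover have "arccos (x \<bullet> (cis (- \<nu> * (\<tau> + integral {r..s} f + integral {s..t} f)) *s \<gamma> t))
        \<le> arccos (x \<bullet> (cis (- \<nu> * (\<tau> + integral {r..s} f)) *s \<gamma> s)) + \<mu> * integral {s..t} f"
        using join by blast
      ultimately show ?thesis
        by (simp add: e distrib_left add.assoc)
    qed
    then show ?case using f by blast
  qed
  then show ?thesis
    by (auto simp: l_def finsler_length_def f_def[abs_def] pathstart_def pathfinish_def dest: spec[of _ 0])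
qed

text \<open>The distance is attained by the great circle arc leaving \<open>x\<close> in direction
  \<open>v\<close>, carried along by the wind, which has constant Finsler speed \<open>T\<close>. A
  shorter curve would require an angle to grow faster than a rotation at rate
  \<open>\<bar>\<nu>\<bar>\<close> allows.\<close>

lemma finsler_dist_eqI:
  fixes x v y :: "complex^'m"
  assumes x: "norm x = 1" and v: "norm v = 1" and orth: "x \<bullet> v = 0"
    and T: "T \<ge> 0" "\<mu> * T \<le> pi"
    and y: "y = cis (\<nu> * T) *s (cos (\<mu> * T) *\<^sub>R x + sin (\<mu> * T) *\<^sub>R v)"
  shows "finsler_dist (sphere 0 1) (randers a b c) x y = T"
proof -
  define \<theta> where "\<theta> = \<mu> * T"
  define g where "g t = cos (\<theta> * t) *\<^sub>R x + sin (\<theta> * t) *\<^sub>R v" for t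
  define g' where "g' t = \<theta> *\<^sub>R (- sin (\<theta> * t) *\<^sub>R x + cos (\<theta> * t) *\<^sub>R v)" for t
  define \<gamma> where "\<gamma> t = cis (\<nu> * T * t) *s g t" for t
  have combo: "norm (p *\<^sub>R x + q *\<^sub>R v) = 1" if "p\<^sup>2 + q\<^sup>2 = 1" for p q
  proof -
    have "(norm (p *\<^sub>R x + q *\<^sub>R v))\<^sup>2 = p\<^sup>2 * (norm x)\<^sup>2 + q\<^sup>2 * (norm v)\<^sup>2 + 2 * p * q * (x \<bullet> v)"
      unfolding power2_norm_eq_inner
      by (simp add: inner_add inner_commute[of v x] power2_eq_square algebra_simps)
    then have "(norm (p *\<^sub>R x + q *\<^sub>R v))\<^sup>2 = 1"
      using that x v orth by simp
    then show ?thesis by (simp add: power2_eq_1_iff) (smt (verit) norm_ge_zero)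
  qed
  have ng: "norm (g t) = 1" for t
    unfolding g_def by (rule combo) simp
  have n\<gamma>: "norm (\<gamma> t) = 1" for t
    by (simp add: \<gamma>_def norm_vector_scalar_mult ng)
  have dg: "(g has_vector_derivative g' t) (at t)" for t
    unfolding g_def g'_def
    by (auto intro!: derivative_eq_intros simp: algebra_simps has_real_derivative_iff_has_vector_derivative[symmetric])
  define \<gamma>' where "\<gamma>' t = cis (\<nu> * T * t) *s (g' t + (\<i> * complex_of_real (\<nu> * T)) *s g t)" for t
  have d\<gamma>: "(\<gamma> has_vector_derivative \<gamma>' t) (at t)" for t
    unfolding \<gamma>_def \<gamma>'_def
    by (rule has_vector_derivative_cis_scale[OF _ dg]) (auto intro!: derivative_eq_intros)
  have speed: "randers a b c (\<gamma> t) (\<gamma>' t) = T" for t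
  proof (rule randers_eqI[OF n\<gamma> T(1)])
    have "norm (g' t) = \<mu> * T"
      unfolding g'_def norm_scaleR using combo[of "- sin (\<theta> * t)" "cos (\<theta> * t)"] \<mu>_pos T
      by (simp add: \<theta>_def)
    moreover have "\<gamma>' t - (\<i> * complex_of_real (\<nu> * T)) *s \<gamma> t = cis (\<nu> * T * t) *s g' t"
      by (simp add: \<gamma>_def \<gamma>'_def vec_eq_iff algebra_simps)
    ultimately show "norm (\<gamma>' t - (\<i> * complex_of_real (\<nu> * T)) *s \<gamma> t) = \<mu> * T"
      by (simp add: norm_vector_scalar_mult)
  qed
  have len: "finsler_length (randers a b c) \<gamma> = T"
  proof -
    have "randers a b c (\<gamma> t) (vector_derivative \<gamma> (at t within {0..1})) = T" if "t \<in> {0..1}" for t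
      unfolding vector_derivative_within_closed_interval[OF zero_less_one that has_vector_derivative_at_within[OF d\<gamma>]]
      by (rule speed)
    then have "finsler_length (randers a b c) \<gamma> = integral {0..1} (\<lambda>t::real. T)"
      unfolding finsler_length_def by (rule Henstock_Kurzweil_Integration.integral_cong)
    then show ?thesis by simp
  qed
  have pw: "piecewise_smooth \<gamma>"
  proof -
    \<comment> \<open>Euler's formula splits \<open>g\<close> into frequencies
      \<open>\<theta>\<close> and \<open>- \<theta>\<close>; the wind shifts both by
      \<open>\<nu> * T\<close>.\<close>
    define p q where "p = (1/2) *s (x - \<i> *s v)" and "q = (1/2) *s (x + \<i> *s v)"
    have "g t = cis (\<theta> * t) *s p + cis (- \<theta> * t) *s q" for t
      by (simp add: g_def p_def q_def vec_eq_iff complex_eq_iff field_simps)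
    then have "\<gamma> = (\<lambda>t. cis ((\<nu> * T + \<theta>) * t) *s p + cis ((\<nu> * T - \<theta>) * t) *s q)"
      by (simp add: fun_eq_iff \<gamma>_def vector_add_ldistrib cis_mult distrib_right left_diff_distrib)
    then have "Ck_on k \<gamma> UNIV" for k
      by (simp only: Ck_on_cis_scale_sum)
    then have "smooth_on S \<gamma>" for S
      unfolding smooth_on_def by blast
    moreover have "continuous_on {0..1} \<gamma>"
      by (rule continuous_on_vector_derivative[OF has_vector_derivative_at_within[OF d\<gamma>]])
    ultimately show ?thesis
      unfolding piecewise_smooth_def by blast
  qed
  have ends: "pathstart \<gamma> = x" "pathfinish \<gamma> = y"
    by (simp_all add: pathstart_def pathfinish_def \<gamma>_def g_def y \<theta>_def)
  have ny: "norm y = 1"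
    using n\<gamma>[of 1] ends(2) by (simp add: pathfinish_def)
  have lower: "T \<le> finsler_length (randers a b c) \<delta>"
    if \<delta>: "piecewise_smooth \<delta>" "path_image \<delta> \<subseteq> sphere 0 1" "pathstart \<delta> = x" "pathfinish \<delta> = y" for \<delta>
  proof (rule ccontr)
    define l where "l = finsler_length (randers a b c) \<delta>"
    assume "\<not> T \<le> finsler_length (randers a b c) \<delta>"
    then have "l < T" by (simp add: l_def)
    have "x \<bullet> x = 1" using x by (simp add: norm_eq_1)
    then have up: "arccos (x \<bullet> (cis (- \<nu> * l) *s y)) \<le> \<mu> * l"
      using arccos_randers_length_le[OF \<delta>(1,2) x] \<delta> by (simp add: l_def)
    have "cis (- \<nu> * T) *s y = cos \<theta> *\<^sub>R x + sin \<theta> *\<^sub>R v"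
      by (simp add: y \<theta>_def cis_mult)
    then have "x \<bullet> (cis (- \<nu> * T) *s y) = cos \<theta>"
      by (simp add: inner_add_right orth \<open>x \<bullet> x = 1\<close>)
    moreover have "\<theta> \<ge> 0" "\<theta> \<le> pi" using T \<mu>_pos by (simp_all add: \<theta>_def)
    ultimately have end_val: "arccos (x \<bullet> (cis (- \<nu> * T) *s y)) = \<mu> * T"
      by (simp add: arccos_cos \<theta>_def)
    \<comment> \<open>From time \<open>l\<close> to \<open>T\<close> the angle between
      \<open>x\<close> and \<open>cis (- \<nu> * p) *s y\<close> grows by at least
      \<open>\<mu> * (T - l)\<close>, while the point moves only at speed
      \<open>\<bar>\<nu>\<bar>\<close>. The summand 0 below is the derivative of the constant curve
      \<open>y\<close>.\<close>
    have "arccos (x \<bullet> (cis (- \<nu> * T) *s y)) - arccos (x \<bullet> (cis (- \<nu> * l) *s y)) \<le> \<bar>\<nu>\<bar> * T - \<bar>\<nu>\<bar> * l"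
    proof (rule arccos_inner_curve_le[where l' = "\<lambda>_. \<bar>\<nu>\<bar>" and
          \<beta>' = "\<lambda>p. cis (- \<nu> * p) *s (0 + (\<i> * complex_of_real (- \<nu>)) *s y)"])
      fix p
      show "((\<lambda>p. cis (- \<nu> * p) *s y) has_vector_derivative
          cis (- \<nu> * p) *s (0 + (\<i> * complex_of_real (- \<nu>)) *s y)) (at p within {l..T})"
        by (rule has_vector_derivative_cis_scale) (auto intro!: derivative_eq_intros)
      show "((\<lambda>p. \<bar>\<nu>\<bar> * p) has_real_derivative \<bar>\<nu>\<bar>) (at p within {l..T})"
        by (auto intro!: derivative_eq_intros)
    qed (use \<open>l < T\<close> x ny in \<open>auto simp: norm_vector_scalar_mult norm_mult\<close>)
    then have "\<mu> * (T - l) \<le> \<bar>\<nu>\<bar> * (T - l)"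
      using end_val up by (simp add: right_diff_distrib)
    then show False
      using wind_slow \<open>l < T\<close> by simp
  qed
  show ?thesis
    unfolding finsler_dist_def
  proof (rule cInf_eq_minimum)
    show "T \<in> {finsler_length (randers a b c) \<gamma> |\<gamma>. piecewise_smooth \<gamma> \<and> path_image \<gamma> \<subseteq> sphere 0 1 \<and>
        pathstart \<gamma> = x \<and> pathfinish \<gamma> = y}"
      using len pw ends n\<gamma> by (fastforce simp: path_image_def)
  qed (use lower in blast)
qed

text \<open>Intermediate value theorem for \<open>\<mu> * T - arccos (x \<bullet> z T)\<close> on
  \<open>{0..pi / \<mu>}\<close>: as \<open>arccos\<close> takes values in \<open>{0..pi}\<close>,
  the signs at the ends are right. The part of \<open>z T\<close> orthogonal to \<open>x\<close>
  then provides \<open>v\<close>.\<close>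

lemma obtain_travel_time:
  fixes x y :: "complex^'m"
  assumes x: "norm x = 1" and y: "norm y = 1"
  obtains T v where "T \<ge> 0" "\<mu> * T \<le> pi" "norm v = 1" "x \<bullet> v = 0"
    "y = cis (\<nu> * T) *s (cos (\<mu> * T) *\<^sub>R x + sin (\<mu> * T) *\<^sub>R v)"
proof -
  define z where "z T = cis (- \<nu> * T) *s y" for T
  have nz: "norm (z T) = 1" for T
    using y by (simp add: z_def norm_vector_scalar_mult)
  have bnd: "-1 \<le> x \<bullet> z T \<and> x \<bullet> z T \<le> 1" for T
    using Cauchy_Schwarz_ineq2[of x "z T"] x nz by auto
  have "continuous_on {0..pi / \<mu>} z"
    unfolding z_def vector_scalar_mult_def by (intro continuous_intros)
  then have cont: "continuous_on {0..pi / \<mu>} (\<lambda>T. \<mu> * T - arccos (x \<bullet> z T))"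
    using bnd by (intro continuous_intros) auto
  obtain T where T: "T \<ge> 0" "T \<le> pi / \<mu>" and eq: "\<mu> * T = arccos (x \<bullet> z T)"
    using IVT'[OF _ _ _ cont, of 0] arccos_lbound[of "x \<bullet> z 0"] arccos_ubound[of "x \<bullet> z (pi / \<mu>)"] bnd \<mu>_pos
    by auto
  have xz: "x \<bullet> z T = cos (\<mu> * T)"
    using bnd by (simp add: eq cos_arccos)
  have xx: "x \<bullet> x = 1" and zz: "z T \<bullet> z T = 1"
    using x nz by (simp_all add: norm_eq_1)
  define w where "w = z T - cos (\<mu> * T) *\<^sub>R x"
  have "(norm w)\<^sup>2 = 1 - (cos (\<mu> * T))\<^sup>2"
    unfolding power2_norm_eq_inner w_def
    by (simp add: inner_diff xx zz xz inner_commute[of "z T" x] power2_eq_square)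
  then have nw: "norm w = \<bar>sin (\<mu> * T)\<bar>"
    by (metis norm_ge_zero power2_abs abs_ge_zero power2_eq_imp_eq sin_squared_eq)
  have xw: "x \<bullet> w = 0"
    by (simp add: w_def inner_diff xx xz)
  obtain v where v: "norm v = 1" "x \<bullet> v = 0" "w = sin (\<mu> * T) *\<^sub>R v"
  \<comment> \<open>For a vanishing sine the direction is undetermined, and \<open>\<i> *s x\<close>
    is a unit vector orthogonal to \<open>x\<close>. Otherwise \<open>w\<close> is divided by the
    signed sine, so that no sign is lost.\<close>
  proof (cases "sin (\<mu> * T) = 0")
    case True
    then have "w = 0" using nw by simp
    then show ?thesis
      using that[of "\<i> *s x"] True x by (simp add: inner_imaginary_scale_self norm_vector_scalar_mult)
  next
    case False
    then show ?thesis
      using that[of "(1 / sin (\<mu> * T)) *\<^sub>R w"] nw xw by simp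
  qed
  have "y = cis (\<nu> * T) *s z T"
    by (simp add: z_def cis_mult)
  also have "z T = cos (\<mu> * T) *\<^sub>R x + sin (\<mu> * T) *\<^sub>R v"
    using v(3) by (metis w_def add.commute diff_eq_eq)
  finally show thesis
    using that[of T v] T v \<mu>_pos by (simp add: field_simps)
qed

section \<open>Construction of the Clifford-Wolf translation\<close>

lemma Clifford_Wolf_homogeneous_sphere:
  "Clifford_Wolf_homogeneous (sphere (0 :: complex^'m) 1) (randers a b c)"
  unfolding Clifford_Wolf_homogeneous_def
proof (intro ballI)
  fix x y :: "complex^'m"
  assume "x \<in> sphere 0 1" "y \<in> sphere 0 1"
  then have x: "norm x = 1" and "norm y = 1" by simp_all
  then obtain T v where T: "T \<ge> 0" "\<mu> * T \<le> pi" and v: "norm v = 1" "x \<bullet> v = 0"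
    and y: "y = cis (\<nu> * T) *s (cos (\<mu> * T) *\<^sub>R x + sin (\<mu> * T) *\<^sub>R v)"
    by (rule obtain_travel_time)
  obtain J where add: "\<And>y z. J (y + z) = J y + J z" and scale: "\<And>k z. J (k *s z) = k *s J z"
    and iso: "\<And>y z. hermitian (J y) (J z) = hermitian y z"
    and skew: "\<And>y z. hermitian (J y) z = - hermitian y (J z)" and Jx: "J x = v"
    using obtain_unitary_complex_structure[OF x v] by metis
  define C where "C = complex_of_real (cos (\<mu> * T))"
  define S where "S = complex_of_real (sin (\<mu> * T))"
  define \<sigma> where "\<sigma> z = cis (\<nu> * T) *s (C *s z + S *s J z)" for z
  have CS: "C * C + S * S = 1"
    using sin_cos_squared_add2[of "\<mu> * T"] by (simp add: C_def S_def flip: of_real_mult of_real_add)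
  have "finsler_isometry (sphere 0 1) (randers a b c) \<sigma>"
  proof (rule unitary_finsler_isometry)
    fix y z
    \<comment> \<open>\<open>J\<close> squares to minus the identity, inside the Hermitian product.
      Skewness cancels the mixed terms of the product below, leaving the squares of cosine and
      sine.\<close>
    have "hermitian y (J (J z)) = - hermitian y z"
      by (metis iso skew minus_minus)
    moreover have "cnj C = C" "cnj S = S"
      by (simp_all add: C_def S_def)
    ultimately have "hermitian (\<sigma> y) (\<sigma> z)
      = cnj (cis (\<nu> * T)) * cis (\<nu> * T) * ((C * C + S * S) * hermitian y z)"
      by (simp add: \<sigma>_def hermitian_simps skew algebra_simps)
    then show "hermitian (\<sigma> y) (\<sigma> z) = hermitian y z"
      by (simp add: CS cis_cnj cis_mult)
  qed (simp_all add: \<sigma>_def add scale vec_eq_iff algebra_simps)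
  moreover have "finsler_dist (sphere 0 1) (randers a b c) z (\<sigma> z) = T" if "z \<in> sphere 0 1" for z
  \<comment> \<open>The direction at \<open>z\<close> is \<open>J z\<close>, while \<open>T\<close>
    is the one found for \<open>x\<close> and \<open>y\<close>; hence the displacement is
    constant.\<close>
  proof (rule finsler_dist_eqI[OF _ _ _ T])
    show z: "norm z = 1" using that by simp
    have "complex_of_real ((norm (J z))\<^sup>2) = complex_of_real ((norm z)\<^sup>2)"
      using iso[of z z] by (simp only: hermitian_self)
    then have "(norm (J z))\<^sup>2 = 1" using z by (simp only: of_real_eq_iff) simp
    then show "norm (J z) = 1"
      by (metis norm_ge_zero one_power2 power2_eq_imp_eq zero_le_one)
    have "cnj (hermitian z (J z)) = - hermitian z (J z)"
      unfolding cnj_hermitian by (rule skew)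
    then show "z \<bullet> J z = 0" by (simp add: inner_eq_Re_hermitian complex_eq_iff)
    show "\<sigma> z = cis (\<nu> * T) *s (cos (\<mu> * T) *\<^sub>R z + sin (\<mu> * T) *\<^sub>R J z)"
      by (simp add: \<sigma>_def C_def S_def scaleR_eq_vector_scalar_mult)
  qed
  moreover have "\<sigma> x = y"
    by (simp add: \<sigma>_def Jx y C_def S_def scaleR_eq_vector_scalar_mult)
  ultimately show "\<exists>\<sigma>. Clifford_Wolf_translation (sphere 0 1) (randers a b c) \<sigma> \<and> \<sigma> x = y"
    unfolding Clifford_Wolf_translation_def by blast
qed

end

theorem theorem5p3:
  fixes n :: nat and a b c :: real
  assumes "n \<ge> 1"
    and "CARD('m::finite) = n + 1"
    and "a > 0" and "b > 0" and "c \<noteq> 0"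
    and "a = b + c\<^sup>2"
  shows "Clifford_Wolf_homogeneous (sphere (0 :: complex^'m) 1) (randers a b c)"
proof -
  interpret zermelo_randers a b c
    using assms by unfold_locales
  show ?thesis by (rule Clifford_Wolf_homogeneous_sphere)
qed

end
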